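(* Fix $k\in\mathbb{N}$ and let $n \geq 3k^3\binom{2k}{k}$. If $\omega:[n]\to\mathbb{R}_{\geq 0}$ is a non-trivial increasing weight function and $\mathcal{F}$ is a $k$-uniform MLCIF on $[n]$ which is optimal for $\omega$, then $\mathcal{F}$ is a canonical MLCIF, i.e. $\mathcal{F}=\langle i\rangle$ for some $i\in[k]$. Moreover, for each $i\in[k]$ there exists an increasing weight function $\omega:[n]\to\mathbb{R}_{\geq 0}$ for which $\langle i\rangle$ is uniquely optimal for $\omega$.
   Context: For $G=\{y_1<\dots<y_k\}$, $F=\{x_1<\dots<x_k\}$ in $\binom{[n]}{k}$, write $G\leq_{\mathrm{LC}} F$ if $y_i\le x_i$ for all $i\in[k]$. A family $\mathcal{F}\subseteq\binom{[n]}{k}$ is left-compressed if it is closed under $\leq_{\mathrm{LC}}$-smaller sets. A $k$-uniform MLCIF on $[n]$ is a left-compressed intersecting family $\mathcal{F}\subseteq\binom{[n]}{k}$ that is maximal under inclusion among such families. For $i\in[k]$, the $i$-th canonical MLCIF is $\langle i\rangle := \{F\in\binom{[n]}{k} : |F\cap[2i-1]|\geq i\}$. For a weight function $\omega:[n]\to\mathbb{R}_{\ge0}$, define $\omega(F)=\prod_{x\in F}\omega(x)$ for $F\in\binom{[n]}{k}$ and $\omega(\mathcal{F})=\sum_{F\in\mathcal{F}}\omega(F)$. $\omega$ is trivial if every $k$-uniform MLCIF $\mathcal{F}$ on $[n]$ has $\omega(\mathcal{F})=0$, non-trivial otherwise; $\omega$ is increasing if $\omega(i)\le\omega(j)$ whenever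 $i\le j$. A $k$-uniform MLCIF $\mathcal{F}$ is optimal for $\omega$ if $\omega(\mathcal{F})\ge\omega(\mathcal{G})$ for every $k$-uniform MLCIF $\mathcal{G}$ on $[n]$, and uniquely optimal if the inequality is strict for every such $\mathcal{G}\neq\mathcal{F}$. *)

theory Defs
  imports Complex_Main "HOL-Library.Ramsey"
begin

text \<open>
  The ground set \<open>[n]\<close> is \<open>{1..n}\<close>, and the family of its \<open>k\<close>-subsets is
  \<open>nsets {1..n} k\<close>.
\<close>

text \<open>
  The increasing enumeration \<open>y\<^sub>1 < \<dots> < y\<^sub>k\<close> of a finite set is its
  \<open>sorted_list_of_set\<close>; \<open>list_all2\<close> compares equal positions (and is false for sets of
  different sizes, a case that does not arise below).
\<close>

definition lc_le :: "nat set \<Rightarrow> nat set \<Rightarrow> bool" where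
  "lc_le G F \<longleftrightarrow> list_all2 (\<le>) (sorted_list_of_set G) (sorted_list_of_set F)"

definition left_compressed :: "nat \<Rightarrow> nat \<Rightarrow> nat set set \<Rightarrow> bool" where
  "left_compressed n k \<F> \<longleftrightarrow>
     \<F> \<subseteq> nsets {1..n} k \<and> (\<forall>F\<in>\<F>. \<forall>G\<in>nsets {1..n} k. lc_le G F \<longrightarrow> G \<in> \<F>)"

definition intersecting :: "'a set set \<Rightarrow> bool" where
  "intersecting \<F> \<longleftrightarrow> (\<forall>A\<in>\<F>. \<forall>B\<in>\<F>. A \<inter> B \<noteq> {})"

definition is_lcif :: "nat \<Rightarrow> nat \<Rightarrow> nat set set \<Rightarrow> bool" where
  "is_lcif n k \<F> \<longleftrightarrow> left_compressed n k \<F> \<and> intersecting \<F>"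

definition is_mlcif :: "nat \<Rightarrow> nat \<Rightarrow> nat set set \<Rightarrow> bool" where
  "is_mlcif n k \<F> \<longleftrightarrow> is_lcif n k \<F> \<and> (\<forall>\<G>. is_lcif n k \<G> \<and> \<F> \<subseteq> \<G> \<longrightarrow> \<G> = \<F>)"

text \<open>Only meaningful for \<open>1 \<le> i \<le> k\<close>.\<close>

definition canonical_mlcif :: "nat \<Rightarrow> nat \<Rightarrow> nat \<Rightarrow> nat set set" where
  "canonical_mlcif n k i = {F \<in> nsets {1..n} k. card (F \<inter> {1..2 * i - 1}) \<ge> i}"

text \<open>
  A weight function on \<open>[n]\<close> is a total function on \<open>nat\<close>, of which only the values on
  \<open>{1..n}\<close> are constrained and used.
\<close>

definition weight_function :: "nat \<Rightarrow> (nat \<Rightarrow> real) \<Rightarrow> bool" where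
  "weight_function n \<omega> \<longleftrightarrow> (\<forall>x\<in>{1..n}. 0 \<le> \<omega> x)"

definition increasing_weight :: "nat \<Rightarrow> (nat \<Rightarrow> real) \<Rightarrow> bool" where
  "increasing_weight n \<omega> \<longleftrightarrow> weight_function n \<omega> \<and> mono_on {1..n} \<omega>"

definition set_weight :: "(nat \<Rightarrow> real) \<Rightarrow> nat set \<Rightarrow> real" where
  "set_weight \<omega> F = (\<Prod>x\<in>F. \<omega> x)"

definition family_weight :: "(nat \<Rightarrow> real) \<Rightarrow> nat set set \<Rightarrow> real" where
  "family_weight \<omega> \<F> = (\<Sum>F\<in>\<F>. set_weight \<omega> F)"

definition trivial_weight :: "nat \<Rightarrow> nat \<Rightarrow> (nat \<Rightarrow> real) \<Rightarrow> bool" where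
  "trivial_weight n k \<omega> \<longleftrightarrow> (\<forall>\<F>. is_mlcif n k \<F> \<longrightarrow> family_weight \<omega> \<F> = 0)"

definition optimal :: "nat \<Rightarrow> nat \<Rightarrow> (nat \<Rightarrow> real) \<Rightarrow> nat set set \<Rightarrow> bool" where
  "optimal n k \<omega> \<F> \<longleftrightarrow>
     is_mlcif n k \<F> \<and> (\<forall>\<G>. is_mlcif n k \<G> \<longrightarrow> family_weight \<omega> \<F> \<ge> family_weight \<omega> \<G>)"

definition uniquely_optimal :: "nat \<Rightarrow> nat \<Rightarrow> (nat \<Rightarrow> real) \<Rightarrow> nat set set \<Rightarrow> bool" where
  "uniquely_optimal n k \<omega> \<F> \<longleftrightarrow>
     is_mlcif n k \<F> \<and>
     (\<forall>\<G>. is_mlcif n k \<G> \<and> \<G> \<noteq> \<F> \<longrightarrow> family_weight \<omega> \<F> > family_weight \<omega> \<G>)"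

end

theory Submission
  imports Defs
begin

text \<open>
  Every set \<open>A\<close> in a left-compressed intersecting family has a least level \<open>l \<le> k\<close> with
  \<open>\<bar>A \<inter> [2l - 1]\<bar> \<ge> l\<close>, and the sets of level \<open>l\<close> lie in \<open>\<langle>l\<rangle>\<close>. Call \<open>A\<close> full if it avoids
  \<open>{2l..2k - 1}\<close>. At a given level, the sets that are not full carry only a small fraction of the
  weight, since exchanging an element of \<open>{2l..2k - 1}\<close> for a larger one in \<open>{2k..n}\<close> does not
  decrease it. The intersection property forces all full members of the family to have the same
  level \<open>s\<close>; and unless the family is \<open>\<langle>s\<rangle>\<close>, none of them has trace \<open>{s..2s - 1}\<close> on
  \<open>[2s - 1]\<close>. This is the heaviest of at most \<open>2k choose k\<close> possible traces, so the full members
  lose at least a \<open>1 / (2k choose k)\<close> fraction of the weight of \<open>\<langle>s\<rangle>\<close>, which the non-full ones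
  cannot make up for.

  A weight that vanishes below \<open>i\<close>, is \<open>1\<close> on \<open>{i..2k - 1}\<close> and huge above annihilates \<open>\<langle>j\<rangle>\<close> for
  \<open>j < i\<close>, and makes \<open>\<langle>i\<rangle>\<close> win over \<open>\<langle>j\<rangle>\<close> for \<open>j > i\<close>.
\<close>

section \<open>The order \<open>lc_le\<close> through counts on initial segments\<close>

text \<open>Trades positions for counts. Positions start at 0, so exactly \<open>i\<close> elements
  precede entry \<open>i\<close>, hence the strict inequality on the right.\<close>

lemma sorted_list_of_set_nth_le_iff:
  fixes A :: "nat set"
  assumes "finite A" "i < card A"
  shows "sorted_list_of_set A ! i \<le> m \<longleftrightarrow> i < card (A \<inter> {..m})"
proof -
  let ?xs = "sorted_list_of_set A"
  have len: "length ?xs = card A" and set: "set ?xs = A"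
    and sorted: "sorted ?xs" and dist: "distinct ?xs"
    using assms by auto
  have inj: "inj_on ((!) ?xs) {..<card A}"
    using dist len by (simp add: inj_on_def nth_eq_iff_index_eq)
  show ?thesis
  proof
    assume le: "?xs ! i \<le> m"
    have "(!) ?xs ` {..i} \<subseteq> A \<inter> {..m}"
    proof
      fix y assume "y \<in> (!) ?xs ` {..i}"
      then obtain j where j: "j \<le> i" "y = ?xs ! j" by auto
      then have "y \<le> ?xs ! i" using sorted len assms(2) by (simp add: sorted_nth_mono)
      moreover have "y \<in> A" using j len set assms(2) nth_mem[of j ?xs] by simp
      ultimately show "y \<in> A \<inter> {..m}" using le by simp
    qed
    then have "card ((!) ?xs ` {..i}) \<le> card (A \<inter> {..m})"
      using assms(1) by (intro card_mono) auto
    moreover have "card ((!) ?xs ` {..i}) = card {..i}"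
      using assms(2) by (intro card_image inj_on_subset[OF inj]) auto
    ultimately show "i < card (A \<inter> {..m})" by simp
  next
    assume less: "i < card (A \<inter> {..m})"
    show "?xs ! i \<le> m"
    proof (rule ccontr)
      assume gt: "\<not> ?xs ! i \<le> m"
      have "A \<inter> {..m} \<subseteq> (!) ?xs ` {..<i}"
      proof
        fix y assume y: "y \<in> A \<inter> {..m}"
        then obtain j where j: "j < length ?xs" "y = ?xs ! j"
          using set by (metis IntD1 in_set_conv_nth)
        have "j < i"
        proof (rule ccontr)
          assume "\<not> j < i"
          then have "?xs ! i \<le> ?xs ! j" using sorted j(1) by (simp add: sorted_nth_mono)
          then show False using y j gt by simp
        qed
        then show "y \<in> (!) ?xs ` {..<i}" using j by simp
      qed
      then have "card (A \<inter> {..m}) \<le> card ((!) ?xs ` {..<i})" by (intro card_mono) auto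
      also have "\<dots> \<le> i" using card_image_le[of "{..<i}" "(!) ?xs"] by simp
      finally show False using less by simp
    qed
  qed
qed

text \<open>Each direction tests one critical point: position
  \<open>card (G \<inter> {..m})\<close>, where \<open>G\<close> has already passed
  \<open>m\<close>, and conversely \<open>m\<close> equal to entry \<open>i\<close> of
  \<open>F\<close>. All later arguments use \<open>lc_le\<close> in this counting form.\<close>

lemma lc_le_iff_card_le:
  assumes "finite G" "finite F" "card G = card F"
  shows "lc_le G F \<longleftrightarrow> (\<forall>m. card (F \<inter> {..m}) \<le> card (G \<inter> {..m}))"
proof
  assume lc: "lc_le G F"
  show "\<forall>m. card (F \<inter> {..m}) \<le> card (G \<inter> {..m})"
  proof (intro allI leI notI)
    fix m assume less: "card (G \<inter> {..m}) < card (F \<inter> {..m})"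
    let ?i = "card (G \<inter> {..m})"
    have "card (F \<inter> {..m}) \<le> card F" using assms by (intro card_mono) auto
    then have i: "?i < card F" using less by simp
    then have "sorted_list_of_set F ! ?i \<le> m"
      using less sorted_list_of_set_nth_le_iff[OF assms(2)] by simp
    moreover have "sorted_list_of_set G ! ?i \<le> sorted_list_of_set F ! ?i"
      using lc i assms unfolding lc_le_def list_all2_conv_all_nth by simp
    ultimately show False
      using i assms sorted_list_of_set_nth_le_iff[OF assms(1), of ?i m] by simp
  qed
next
  assume le: "\<forall>m. card (F \<inter> {..m}) \<le> card (G \<inter> {..m})"
  have "sorted_list_of_set G ! i \<le> sorted_list_of_set F ! i" if i: "i < card F" for i
  proof -
    let ?m = "sorted_list_of_set F ! i"
    have "i < card (F \<inter> {..?m})"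
      using sorted_list_of_set_nth_le_iff[OF assms(2) i, of ?m] by simp
    then have "i < card (G \<inter> {..?m})" using le order.strict_trans2 by blast
    then show ?thesis
      using sorted_list_of_set_nth_le_iff[OF assms(1), of i ?m] i assms(3) by simp
  qed
  then show "lc_le G F"
    using assms unfolding lc_le_def list_all2_conv_all_nth by simp
qed

lemma lc_le_nsets_iff:
  assumes "G \<in> nsets {1..n} k" "F \<in> nsets {1..n} k"
  shows "lc_le G F \<longleftrightarrow> (\<forall>m. card (F \<inter> {1..m}) \<le> card (G \<inter> {1..m}))"
proof -
  have "A \<inter> {..m} = A \<inter> {1..m}" if "A \<in> nsets {1..n} k" for A and m :: nat
    using that by (auto simp: nsets_def)
  then show ?thesis
    using assms lc_le_iff_card_le[of G F] by (auto simp: nsets_def)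
qed

lemma card_Int_upto_mono:
  fixes a b :: nat
  assumes "a \<le> b"
  shows "card (A \<inter> {1..a}) \<le> card (A \<inter> {1..b})"
  using assms by (intro card_mono) auto

lemma card_Int_upto_diff:
  fixes a b :: nat
  assumes "a \<le> b"
  shows "card (A \<inter> {1..b}) \<le> card (A \<inter> {1..a}) + (b - a)"
proof -
  have "card (A \<inter> {1..b}) \<le> card (A \<inter> {1..a} \<union> {a<..b})" by (intro card_mono) auto
  also have "\<dots> \<le> card (A \<inter> {1..a}) + card {a<..b}" by (rule card_Un_le)
  finally show ?thesis by simp
qed

lemma card_Int_upto_le:
  "A \<in> nsets {1..n} k \<Longrightarrow> card (A \<inter> {1..m}) \<le> k"
  using card_mono[of A "A \<inter> {1..m}"] by (auto simp: nsets_def)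

section \<open>What intersection forces on initial counts\<close>

text \<open>The witness consists of the \<open>k\<close> smallest elements of \<open>D\<close>. The
  induction adds elements in increasing order, and the largest one, \<open>b\<close>, is taken only
  if the others are too few.\<close>

lemma ex_initial_subset:
  fixes D :: "nat set"
  assumes "finite D" "k \<le> card D"
  shows "\<exists>C\<subseteq>D. card C = k \<and> (\<forall>m. min k (card (D \<inter> {..m})) \<le> card (C \<inter> {..m}))"
  using assms
proof (induction D arbitrary: k rule: finite_linorder_max_induct)
  case empty
  then show ?case by simp
next
  case (insert b D)
  show ?case
  proof (cases "k \<le> card D")
    case True
    then obtain C where C: "C \<subseteq> D" "card C = k"
      "\<And>m. min k (card (D \<inter> {..m})) \<le> card (C \<inter> {..m})"
      using insert.IH by blast
    have "min k (card (insert b D \<inter> {..m})) \<le> card (C \<inter> {..m})" for m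
    proof (cases "b \<le> m")
      case True
      then have "C \<inter> {..m} = C" using insert.hyps C(1) by fastforce
      then show ?thesis using C(2) by simp
    next
      case False
      then have "insert b D \<inter> {..m} = D \<inter> {..m}" by auto
      then show ?thesis using C(3) by simp
    qed
    then show ?thesis using C(1,2) by blast
  next
    case False
    moreover have "b \<notin> D" using insert.hyps by blast
    ultimately have "k = card (insert b D)" using insert.hyps insert.prems by simp
    then show ?thesis by (intro exI[of _ "insert b D"]) simp
  qed
qed

text \<open>
  Otherwise the \<open>k\<close> smallest elements of the complement of \<open>A\<close> would form a set below \<open>E\<close>,
  hence a member of the family disjoint from \<open>A\<close>.
\<close>

lemma lcif_card_gt:
  assumes F: "is_lcif n k \<F>" and n: "2 * k \<le> n" and A: "A \<in> \<F>" and E: "E \<in> \<F>"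
  obtains m where "m < 2 * k" "m < card (A \<inter> {1..m}) + card (E \<inter> {1..m})"
proof -
  have sub: "A \<in> nsets {1..n} k" "E \<in> nsets {1..n} k"
    using F A E unfolding is_lcif_def left_compressed_def by auto
  have "\<exists>m. m < card (A \<inter> {1..m}) + card (E \<inter> {1..m})"
  proof (rule ccontr)
    assume "\<not> ?thesis"
    then have sum: "card (A \<inter> {1..m}) + card (E \<inter> {1..m}) \<le> m" for m
      by (simp add: not_less)
    have A': "A \<subseteq> {1..n}" "finite A" "card A = k" using sub(1) by (auto simp: nsets_def)
    have "card ({1..n} - A) = n - k" using A' by (simp add: card_Diff_subset)
    then have "k \<le> card ({1..n} - A)" using n by simp
    then obtain C where C: "C \<subseteq> {1..n} - A" "card C = k"
      "\<And>m. min k (card (({1..n} - A) \<inter> {..m})) \<le> card (C \<inter> {..m})"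
      using ex_initial_subset[of "{1..n} - A" k] by blast
    have Cn: "C \<in> nsets {1..n} k"
      using C finite_subset[of C "{1..n}"] by (auto simp: nsets_def)
    have "card (E \<inter> {1..m}) \<le> card (C \<inter> {1..m})" for m
    proof -
      \<comment> \<open>Up to \<open>m \<le> n\<close> the complement of \<open>A\<close> has
        \<open>m - card (A \<inter> {1..m})\<close> elements, and \<open>sum\<close> allows
        \<open>E\<close> no more; for larger \<open>m\<close> it has all its
        \<open>n - k \<ge> k\<close> elements.\<close>
      have "card (E \<inter> {1..m}) \<le> card (({1..n} - A) \<inter> {..m})"
      proof (cases "m \<le> n")
        case True
        then have "({1..n} - A) \<inter> {..m} = {1..m} - A \<inter> {1..m}" by auto
        then have "card (({1..n} - A) \<inter> {..m}) = m - card (A \<inter> {1..m})"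
          by (simp add: card_Diff_subset)
        then show ?thesis using sum[of m] by simp
      next
        case False
        then have "({1..n} - A) \<inter> {..m} = {1..n} - A" by auto
        then show ?thesis
          using card_Int_upto_le[OF sub(2), of m] n \<open>card ({1..n} - A) = n - k\<close> by simp
      qed
      moreover have "card (E \<inter> {1..m}) \<le> k" by (rule card_Int_upto_le[OF sub(2)])
      moreover have "C \<inter> {..m} = C \<inter> {1..m}" using C(1) by auto
      ultimately show ?thesis using C(3)[of m] by simp
    qed
    then have "lc_le C E" using lc_le_nsets_iff[OF Cn sub(2)] by simp
    then have "C \<in> \<F>" using F E Cn unfolding is_lcif_def left_compressed_def by blast
    then have "A \<inter> C \<noteq> {}" using F A unfolding is_lcif_def intersecting_def by blast
    then show False using C(1) by blast
  qed
  then obtain m where m: "m < card (A \<inter> {1..m}) + card (E \<inter> {1..m})" by blast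
  moreover have "m < 2 * k"
    using m card_Int_upto_le[OF sub(1), of m] card_Int_upto_le[OF sub(2), of m] by simp
  ultimately show ?thesis using that by blast
qed

section \<open>Canonical families\<close>

text \<open>Two sets with at least \<open>i\<close> elements each among \<open>2 * i - 1\<close>
  points must meet, and going down in \<open>lc_le\<close> can only raise initial counts.\<close>

lemma canonical_is_lcif:
  assumes i: "1 \<le> i" shows "is_lcif n k (canonical_mlcif n k i)"
  unfolding is_lcif_def left_compressed_def intersecting_def
proof (intro conjI ballI impI)
  show "canonical_mlcif n k i \<subseteq> nsets {1..n} k" by (auto simp: canonical_mlcif_def)
next
  fix F G assume "F \<in> canonical_mlcif n k i" "G \<in> nsets {1..n} k" "lc_le G F"
  then show "G \<in> canonical_mlcif n k i"
    using lc_le_nsets_iff[of G n k F] order.trans unfolding canonical_mlcif_def by blast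
next
  fix A B assume AB: "A \<in> canonical_mlcif n k i" "B \<in> canonical_mlcif n k i"
  show "A \<inter> B \<noteq> {}"
  proof
    assume "A \<inter> B = {}"
    then have "card (A \<inter> {1..2*i-1}) + card (B \<inter> {1..2*i-1})
        = card (A \<inter> {1..2*i-1} \<union> B \<inter> {1..2*i-1})"
      by (intro card_Un_disjoint[symmetric]) auto
    also have "\<dots> \<le> card {1..2*i-1}" by (intro card_mono) auto
    finally have "card (A \<inter> {1..2*i-1}) + card (B \<inter> {1..2*i-1}) \<le> 2 * i - 1" by simp
    moreover have "i \<le> card (A \<inter> {1..2*i-1})" "i \<le> card (B \<inter> {1..2*i-1})"
      using AB unfolding canonical_mlcif_def by auto
    ultimately show False using i by linarith
  qed
qed

text \<open>A \<open>k\<close>-set \<open>A\<close> outside the family misses at least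
  \<open>i\<close> points of \<open>{1..2 * i - 1}\<close>. Such points \<open>S\<close>, filled up
  by \<open>k - i\<close> further points \<open>R\<close> outside \<open>A\<close>, form a member
  disjoint from \<open>A\<close>, so \<open>A\<close> cannot be added.\<close>

lemma canonical_is_mlcif:
  assumes i: "1 \<le> i" "i \<le> k" and n: "2 * k \<le> n"
  shows "is_mlcif n k (canonical_mlcif n k i)"
  unfolding is_mlcif_def
proof (intro conjI allI impI canonical_is_lcif[OF i(1)])
  fix \<G> assume G: "is_lcif n k \<G> \<and> canonical_mlcif n k i \<subseteq> \<G>"
  have "A \<in> canonical_mlcif n k i" if A: "A \<in> \<G>" for A
  proof (rule ccontr)
    assume nA: "A \<notin> canonical_mlcif n k i"
    have An: "A \<in> nsets {1..n} k"
      using G A unfolding is_lcif_def left_compressed_def by auto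
    then have A': "A \<subseteq> {1..n}" "finite A" "card A = k" by (auto simp: nsets_def)
    have "card (A \<inter> {1..2*i-1}) < i" using nA An by (simp add: canonical_mlcif_def)
    moreover have "card ({1..2*i-1} - A) = 2*i-1 - card (A \<inter> {1..2*i-1})"
      using card_Diff_subset_Int[of "{1..2*i-1}" A] by (simp add: Int_commute)
    ultimately have "i \<le> card ({1..2*i-1} - A)" using i by simp
    then obtain S where S: "S \<subseteq> {1..2*i-1} - A" "card S = i" "finite S"
      by (meson obtain_subset_with_card_n)
    have "card ({1..n} - A) = n - k" using A' by (simp add: card_Diff_subset)
    moreover have "{1..2*i-1} \<subseteq> {1..n}" using i n by auto
    then have "S \<subseteq> {1..n} - A" using S(1) by blast
    ultimately have "k - i \<le> card (({1..n} - A) - S)"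
      using S i n by (simp add: card_Diff_subset)
    then obtain R where R: "R \<subseteq> ({1..n} - A) - S" "card R = k - i" "finite R"
      by (meson obtain_subset_with_card_n)
    have "card (S \<union> R) = i + (k - i)"
      using S R card_Un_disjoint[of S R] by auto
    then have "S \<union> R \<in> nsets {1..n} k"
      using S R i \<open>S \<subseteq> {1..n} - A\<close> by (auto simp: nsets_def)
    moreover have "i \<le> card ((S \<union> R) \<inter> {1..2*i-1})"
      using S card_mono[of "(S \<union> R) \<inter> {1..2*i-1}" S] by auto
    ultimately have "S \<union> R \<in> \<G>" using G by (auto simp: canonical_mlcif_def)
    then have "A \<inter> (S \<union> R) \<noteq> {}"
      using G A unfolding is_lcif_def intersecting_def by blast
    then show False using S R by blast
  qed
  then show "\<G> = canonical_mlcif n k i" using G by blast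
qed

section \<open>Levels\<close>

text \<open>A first-passage condition for \<open>l \<ge> 1\<close>: in the walk that steps up at
  elements of \<open>A\<close> and down at other points, \<open>2 * l - 1\<close> is the first time
  at positive height.\<close>

definition first_level :: "nat \<Rightarrow> nat \<Rightarrow> nat \<Rightarrow> nat set set" where
  "first_level n k l = {A \<in> nsets {1..n} k. l \<le> card (A \<inter> {1..2 * l - 1}) \<and>
     (\<forall>j\<in>{1..<l}. card (A \<inter> {1..2 * j - 1}) < j)}"

lemma first_level_nsets: "first_level n k l \<subseteq> nsets {1..n} k"
  by (auto simp: first_level_def)

lemma finite_nsets_upto: "finite (nsets {1..n::nat} k)"
  by (simp add: finite_imp_finite_nsets)

lemma finite_first_level: "finite (first_level n k l)"
  using finite_subset[OF first_level_nsets finite_nsets_upto] .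

lemma first_level_subset_canonical: "first_level n k l \<subseteq> canonical_mlcif n k l"
  by (auto simp: first_level_def canonical_mlcif_def)

text \<open>Before the first passage the walk is never above 0. Odd \<open>m\<close> are covered by
  the definition, and an even \<open>m\<close> is one point beyond an odd one.\<close>

lemma first_level_card_le_half:
  assumes A: "A \<in> first_level n k l" and m: "m \<le> 2 * l - 2"
  shows "card (A \<inter> {1..m}) \<le> m div 2"
proof (cases "even m")
  case True
  then obtain j where j: "m = 2 * j" by blast
  show ?thesis
  proof (cases "j = 0")
    case False
    then have "card (A \<inter> {1..2 * j - 1}) < j" using A m j by (auto simp: first_level_def)
    moreover have "card (A \<inter> {1..2 * j}) \<le> card (A \<inter> {1..2 * j - 1}) + (2 * j - (2 * j - 1))"
      by (rule card_Int_upto_diff) simp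
    ultimately show ?thesis using j False by simp
  qed (use j in simp)
next
  case False
  then obtain j where j: "m = 2 * j + 1" by (elim oddE)
  then have "j + 1 \<in> {1..<l}" using m by auto
  then have "card (A \<inter> {1..2 * (j + 1) - 1}) < j + 1"
    using A unfolding first_level_def by blast
  then show ?thesis using j by simp
qed

text \<open>The walk climbs one unit at a time, so its first positive height is exactly 1.\<close>

lemma first_level_card:
  assumes A: "A \<in> first_level n k l" and l: "1 \<le> l"
  shows "card (A \<inter> {1..2 * l - 1}) = l"
proof -
  have "card (A \<inter> {1..2 * l - 1}) \<le> card (A \<inter> {1..2 * l - 2}) + (2 * l - 1 - (2 * l - 2))"
    by (rule card_Int_upto_diff) simp
  moreover have "card (A \<inter> {1..2 * l - 2}) \<le> (2 * l - 2) div 2"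
    using A by (rule first_level_card_le_half) simp
  ultimately have "card (A \<inter> {1..2 * l - 1}) \<le> l" using l by simp
  then show ?thesis using A by (simp add: first_level_def)
qed

text \<open>Needed for exchanges: the level is decided inside \<open>{1..2 * l - 1}\<close>, so
  elements from \<open>2 * l\<close> on may be replaced freely.\<close>

lemma first_level_cong:
  assumes "A \<in> first_level n k l" "B \<in> nsets {1..n} k"
    "B \<inter> {1..2 * l - 1} = A \<inter> {1..2 * l - 1}"
  shows "B \<in> first_level n k l"
proof -
  have "B \<inter> {1..2 * j - 1} = A \<inter> {1..2 * j - 1}" if "j \<le> l" for j
  proof -
    have "{1..2 * j - 1} \<subseteq> {1..2 * l - 1}" using that by auto
    then show ?thesis using assms(3) by blast
  qed
  then show ?thesis using assms(1,2) by (auto simp: first_level_def)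
qed

lemma first_level_top:
  assumes "A \<in> nsets {1..n} k" "A \<inter> {1..2 * l - 1} = {l..2 * l - 1}" "1 \<le> l"
  shows "A \<in> first_level n k l"
proof -
  have "card (A \<inter> {1..2 * j - 1}) < j" if j: "j \<in> {1..<l}" for j
  proof -
    have "A \<inter> {1..2 * j - 1} = (A \<inter> {1..2 * l - 1}) \<inter> {1..2 * j - 1}" using j by auto
    also have "\<dots> = {l..2 * j - 1}" using assms(2,3) j by auto
    \<comment> \<open>The interval has \<open>2 * j - l\<close> elements (truncated at 0), fewer
      than \<open>j\<close> since \<open>j < l\<close>.\<close>
    finally show ?thesis using j by auto
  qed
  then show ?thesis using assms by (simp add: first_level_def)
qed

lemma first_level_disjoint:
  assumes "l \<noteq> l'" "1 \<le> l" "1 \<le> l'"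
  shows "first_level n k l \<inter> first_level n k l' = {}"
proof -
  have "first_level n k a \<inter> first_level n k b = {}" if "a < b" "1 \<le> a" for a b
  proof -
    have "card (A \<inter> {1..2 * a - 1}) < a" if "A \<in> first_level n k b" for A
      using that \<open>a < b\<close> \<open>1 \<le> a\<close> unfolding first_level_def by auto
    moreover have "a \<le> card (A \<inter> {1..2 * a - 1})" if "A \<in> first_level n k a" for A
      using that unfolding first_level_def by blast
    ultimately show ?thesis using leD by blast
  qed
  then show ?thesis using assms by (metis Int_commute linorder_neqE_nat)
qed

text \<open>\<open>lcif_card_gt\<close> for \<open>A\<close> against itself puts the walk of
  \<open>A\<close> above 0 at some time below \<open>2 * k\<close>, so a first passage
  exists.\<close>

lemma lcif_subset_first_levels:
  assumes F: "is_lcif n k \<F>" and n: "2 * k \<le> n"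
  shows "\<F> \<subseteq> (\<Union>l\<in>{1..k}. first_level n k l)"
proof
  fix A assume A: "A \<in> \<F>"
  then have An: "A \<in> nsets {1..n} k"
    using F unfolding is_lcif_def left_compressed_def by auto
  obtain m where m: "m < 2 * k" "m < card (A \<inter> {1..m}) + card (A \<inter> {1..m})"
    using lcif_card_gt[OF F n A A] by blast
  \<comment> \<open>If \<open>m = 2 * j\<close>, the count exceeds \<open>j\<close> and dropping the
    point \<open>m\<close> leaves at least \<open>j\<close>; if \<open>m = 2 * j - 1\<close>, the
    count is already at least \<open>j\<close>.\<close>
  define j where "j = (m + 1) div 2"
  have j: "1 \<le> j \<and> j \<le> card (A \<inter> {1..2 * j - 1})"
  proof (cases "even m")
    case True
    then have "m = 2 * j" unfolding j_def by presburger
    moreover have "card (A \<inter> {1..m}) \<le> card (A \<inter> {1..m - 1}) + (m - (m - 1))"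
      by (rule card_Int_upto_diff) simp
    ultimately show ?thesis using m by (cases "j = 0") auto
  next
    case False
    then have "m = 2 * j - 1" "1 \<le> j" unfolding j_def by presburger+
    then show ?thesis using m by auto
  qed
  define l where "l = (LEAST l. 1 \<le> l \<and> l \<le> card (A \<inter> {1..2 * l - 1}))"
  have l: "1 \<le> l" "l \<le> card (A \<inter> {1..2 * l - 1})"
    using LeastI[of "\<lambda>l. 1 \<le> l \<and> l \<le> card (A \<inter> {1..2 * l - 1})", OF j]
    unfolding l_def by auto
  have "\<forall>j\<in>{1..<l}. card (A \<inter> {1..2 * j - 1}) < j"
    unfolding l_def using not_less_Least by (metis (no_types, lifting) atLeastLessThan_iff not_le)
  then have "A \<in> first_level n k l" using An l by (simp add: first_level_def)
  moreover have "l \<le> k" using l(2) card_Int_upto_le[OF An] order.trans by blast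
  ultimately show "A \<in> (\<Union>l\<in>{1..k}. first_level n k l)" using l(1) by auto
qed

section \<open>Full sets\<close>

text \<open>For \<open>l \<ge> 1\<close> the other \<open>k - l\<close> elements lie beyond the
  range \<open>m < 2 * k\<close> that \<open>lcif_card_gt\<close> tests, so only the trace on
  \<open>{1..2 * l - 1}\<close> matters there.\<close>

definition full_level :: "nat \<Rightarrow> nat \<Rightarrow> nat \<Rightarrow> nat set set" where
  "full_level n k l = {A \<in> first_level n k l. A \<inter> {2 * l..2 * k - 1} = {}}"

lemma full_level_card:
  assumes A: "A \<in> full_level n k l" and l: "1 \<le> l" and m: "2 * l - 1 \<le> m" "m < 2 * k"
  shows "card (A \<inter> {1..m}) = l"
proof -
  have "A \<inter> {1..m} = A \<inter> {1..2 * l - 1}"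
    using A m by (fastforce simp: full_level_def disjoint_iff)
  then show ?thesis using A l first_level_card by (auto simp: full_level_def)
qed

text \<open>For levels \<open>a < b\<close> the two counts sum to at most \<open>m\<close> for every
  \<open>m < 2 * k\<close>, against \<open>lcif_card_gt\<close>: they are at most
  \<open>m div 2\<close> twice, then \<open>a\<close> and \<open>m div 2\<close> with
  \<open>m \<ge> 2 * a - 1\<close>, then \<open>a + b \<le> 2 * b - 1 \<le> m\<close>.\<close>

lemma full_level_unique:
  assumes F: "is_lcif n k \<F>" and n: "2 * k \<le> n"
    and A: "A \<in> \<F> \<inter> full_level n k l" and E: "E \<in> \<F> \<inter> full_level n k l'"
    and l: "1 \<le> l" "1 \<le> l'"
  shows "l = l'"
proof -
  have False if A: "A \<in> \<F> \<inter> full_level n k a" and E: "E \<in> \<F> \<inter> full_level n k b"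
    and ab: "1 \<le> a" "a < b" for A E a b
  proof -
    obtain m where m: "m < 2 * k" "m < card (A \<inter> {1..m}) + card (E \<inter> {1..m})"
      using lcif_card_gt[OF F n, of A E] A E by auto
    have Al: "A \<in> first_level n k a" and El: "E \<in> first_level n k b"
      using A E by (auto simp: full_level_def)
    consider "m \<le> 2 * a - 2" | "2 * a - 1 \<le> m" "m \<le> 2 * b - 2" | "2 * b - 1 \<le> m"
      by linarith
    then show False
    proof cases
      case 1
      then show False
        using first_level_card_le_half[OF Al, of m] first_level_card_le_half[OF El, of m] m ab
        by linarith
    next
      case 2
      then show False
        using full_level_card[of A n k a m] first_level_card_le_half[OF El, of m] m ab A
        by auto
    next
      case 3
      then show False
        using full_level_card[of A n k a m] full_level_card[of E n k b m] m ab A E by auto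
    qed
  qed
  then show ?thesis using A E l by (metis linorder_neqE_nat)
qed

text \<open>The top trace makes the counts of \<open>E\<close> as small as possible, so
  \<open>lcif_card_gt\<close> forces every \<open>A\<close> in the family to have \<open>l\<close>
  elements in \<open>{1..2 * l - 1}\<close>. Equality then comes from the maximality of
  \<open>\<F>\<close>.\<close>

lemma mlcif_eq_canonical:
  assumes F: "is_mlcif n k \<F>" and n: "2 * k \<le> n" and l: "1 \<le> l" "l \<le> k"
    and E: "E \<in> \<F> \<inter> full_level n k l" and top: "E \<inter> {1..2 * l - 1} = {l..2 * l - 1}"
  shows "\<F> = canonical_mlcif n k l"
proof -
  have lcif: "is_lcif n k \<F>" using F by (simp add: is_mlcif_def)
  have "A \<in> canonical_mlcif n k l" if A: "A \<in> \<F>" for A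
  proof -
    have An: "A \<in> nsets {1..n} k"
      using lcif A unfolding is_lcif_def left_compressed_def by auto
    obtain m where m: "m < 2 * k" "m < card (A \<inter> {1..m}) + card (E \<inter> {1..m})"
      using lcif_card_gt[OF lcif n A, of E] E by auto
    have "l \<le> card (A \<inter> {1..2 * l - 1})"
    proof (cases "m \<le> 2 * l - 1")
      case True
      then have "E \<inter> {1..m} = (E \<inter> {1..2 * l - 1}) \<inter> {1..m}" by auto
      also have "\<dots> = {l..m}" using True top l by auto
      finally have c: "card (E \<inter> {1..m}) = m + 1 - l" by simp
      \<comment> \<open>Excludes \<open>m + 1 < l\<close>, where the difference in \<open>c\<close>
        is truncated to 0.\<close>
      have "card (A \<inter> {1..m}) \<le> m" using card_mono[of "{1..m}" "A \<inter> {1..m}"] by simp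
      then have "l \<le> card (A \<inter> {1..m})" using m c by linarith
      also have "\<dots> \<le> card (A \<inter> {1..2 * l - 1})" using True by (rule card_Int_upto_mono)
      finally show ?thesis .
    next
      case False
      then have "card (E \<inter> {1..m}) = l" using full_level_card[of E n k l m] E l m by auto
      moreover have "card (A \<inter> {1..m}) \<le> card (A \<inter> {1..2 * l - 1}) + (m - (2 * l - 1))"
        using False by (intro card_Int_upto_diff) simp
      ultimately show ?thesis using m False by linarith
    qed
    then show ?thesis using An by (simp add: canonical_mlcif_def)
  qed
  then show ?thesis using F canonical_is_lcif[OF l(1)] unfolding is_mlcif_def by blast
qed

section \<open>Weight comparisons by exchange\<close>

lemma weight_mono:
  assumes "increasing_weight n \<omega>" "1 \<le> x" "x \<le> y" "y \<le> n"
  shows "\<omega> x \<le> \<omega> y"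
  using assms by (auto simp: increasing_weight_def intro: mono_onD)

lemma weight_nonneg:
  assumes "increasing_weight n \<omega>" "x \<in> {1..n}"
  shows "0 \<le> \<omega> x"
  using assms by (auto simp: increasing_weight_def weight_function_def)

lemma set_weight_nonneg:
  assumes "increasing_weight n \<omega>" "A \<subseteq> {1..n}"
  shows "0 \<le> set_weight \<omega> A"
  unfolding set_weight_def using assms weight_nonneg by (intro prod_nonneg) blast

lemma family_weight_mono:
  assumes "increasing_weight n \<omega>" "\<F> \<subseteq> \<G>" "\<G> \<subseteq> nsets {1..n} k"
  shows "family_weight \<omega> \<F> \<le> family_weight \<omega> \<G>"
  unfolding family_weight_def
proof (rule sum_mono2)
  show "finite \<G>" using assms(3) finite_nsets_upto finite_subset by blast
  show "0 \<le> set_weight \<omega> A" if "A \<in> \<G> - \<F>" for A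
    using that assms by (intro set_weight_nonneg) (auto simp: nsets_def)
qed (fact assms(2))

lemma family_weight_nonneg:
  assumes "increasing_weight n \<omega>" "\<F> \<subseteq> nsets {1..n} k"
  shows "0 \<le> family_weight \<omega> \<F>"
  using family_weight_mono[OF assms(1) empty_subsetI assms(2)] by (simp add: family_weight_def)

text \<open>The parts of the two sets outside their intersection have equal size, and
  \<open>\<omega> l\<close> separates them: one part lies below \<open>l\<close>, the other at or
  above \<open>l\<close>.\<close>

lemma set_weight_le_top:
  assumes \<omega>: "increasing_weight n \<omega>" and l: "1 \<le> l" "2 * l - 1 \<le> n"
    and S: "S \<subseteq> {1..2 * l - 1}" "card S = l"
  shows "set_weight \<omega> S \<le> set_weight \<omega> {l..2 * l - 1}"
proof -
  let ?T = "{l..2 * l - 1}"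
  have fin: "finite S" using S(1) finite_subset by blast
  have split: "prod \<omega> A = prod \<omega> (A \<inter> B) * prod \<omega> (A - B)" if "finite A" for A B
    using that by (rule prod.Int_Diff)
  have "card (S - ?T) = card (?T - S)"
    using S(2) l fin card_Diff_subset_Int[of S ?T] card_Diff_subset_Int[of ?T S]
    by (simp add: Int_commute)
  moreover have "prod \<omega> (S - ?T) \<le> (\<Prod>x\<in>S - ?T. \<omega> l)"
  proof (rule prod_mono)
    fix x assume "x \<in> S - ?T"
    then have "1 \<le> x" "x \<le> l" using S by (auto simp: subset_iff)
    then show "0 \<le> \<omega> x \<and> \<omega> x \<le> \<omega> l"
      using weight_mono[OF \<omega>, of x l] weight_nonneg[OF \<omega>, of x] l by auto
  qed
  moreover have "(\<Prod>x\<in>?T - S. \<omega> l) \<le> prod \<omega> (?T - S)"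
  proof (rule prod_mono)
    fix x assume "x \<in> ?T - S"
    then show "0 \<le> \<omega> l \<and> \<omega> l \<le> \<omega> x"
      using weight_mono[OF \<omega>, of l x] weight_nonneg[OF \<omega>, of l] l by auto
  qed
  ultimately have "prod \<omega> (S - ?T) \<le> prod \<omega> (?T - S)" by simp
  moreover have "0 \<le> prod \<omega> (S \<inter> ?T)"
    using weight_nonneg[OF \<omega>] l by (intro prod_nonneg) auto
  ultimately show ?thesis
    unfolding set_weight_def using split[OF fin, of ?T] split[of ?T S]
    by (simp add: Int_commute mult_left_mono)
qed

text \<open>Double counting. A non-full \<open>A\<close> has at least \<open>n - 3 * k\<close>
  choices of \<open>y\<close>; exchanging some \<open>x\<close> in \<open>?X\<close> for
  \<open>y\<close> gives \<open>B\<close> of no smaller weight and the same level. Conversely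
  \<open>B\<close>, \<open>x\<close> and \<open>y\<close> in \<open>B\<close> determine
  \<open>A\<close>, so each \<open>B\<close> is used at most \<open>card ?X * k\<close>
  times.\<close>

lemma non_full_weight_le:
  assumes \<omega>: "increasing_weight n \<omega>" and l: "1 \<le> l" "l \<le> k"
  shows "real (n - 3 * k) * family_weight \<omega> (first_level n k l - full_level n k l)
    \<le> real (2 * (k - 1) * k) * family_weight \<omega> (first_level n k l)"
proof -
  let ?P = "first_level n k l"
  let ?N = "first_level n k l - full_level n k l"
  let ?X = "{2 * l..2 * k - 1}"
  let ?Y = "\<lambda>A. {2 * k..n} - A"
  have P: "finite A" "A \<subseteq> {1..n}" "card A = k" if "A \<in> ?P" for A
    using that by (auto simp: first_level_def nsets_def)
  have nonneg: "0 \<le> set_weight \<omega> A" if "A \<in> ?P" for A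
    using set_weight_nonneg[OF \<omega>] P(2)[OF that] .
  have card_X: "card ?X = 2 * k - 2 * l" using l by simp
  have "real (n - 3 * k) * family_weight \<omega> ?N = (\<Sum>A\<in>?N. real (n - 3 * k) * set_weight \<omega> A)"
    by (simp add: family_weight_def sum_distrib_left)
  also have "\<dots> \<le> (\<Sum>A\<in>?N. \<Sum>y\<in>?Y A. set_weight \<omega> A)"
  proof (rule sum_mono)
    fix A assume A: "A \<in> ?N"
    have "card {2 * k..n} - card A \<le> card (?Y A)"
      using A P by (intro diff_card_le_card_Diff) auto
    then have "n - 3 * k \<le> card (?Y A)" using A P[of A] by auto
    then show "real (n - 3 * k) * set_weight \<omega> A \<le> (\<Sum>y\<in>?Y A. set_weight \<omega> A)"
      using nonneg A by (simp add: mult_right_mono)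
  qed
  also have "\<dots> = (\<Sum>(A, y)\<in>Sigma ?N ?Y. set_weight \<omega> A)"
    by (rule sum.Sigma) (auto simp: finite_first_level)
  also have "\<dots> \<le> (\<Sum>(B, _)\<in>Sigma ?P (\<lambda>B. ?X \<times> B). set_weight \<omega> B)"
  \<comment> \<open>The map \<open>i\<close> undoes the exchange, returning \<open>A\<close>
    together with \<open>y\<close>.\<close>
  proof (rule sum_le_included[where i = "\<lambda>(B, x, y). (insert x (B - {y}), y)"])
    show "finite (Sigma ?N ?Y)" by (auto simp: finite_first_level)
    show "finite (Sigma ?P (\<lambda>B. ?X \<times> B))" using P(1) finite_first_level by auto
    show "\<forall>z\<in>Sigma ?P (\<lambda>B. ?X \<times> B). 0 \<le> (case z of (B, _) \<Rightarrow> set_weight \<omega> B)"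
      using nonneg by auto
    show "\<forall>z\<in>Sigma ?N ?Y. \<exists>t\<in>Sigma ?P (\<lambda>B. ?X \<times> B).
        (case t of (B, x, y) \<Rightarrow> (insert x (B - {y}), y)) = z \<and>
        (case z of (A, y) \<Rightarrow> set_weight \<omega> A) \<le> (case t of (B, _) \<Rightarrow> set_weight \<omega> B)"
    proof (clarify)
      fix A y assume A: "A \<in> ?P" "A \<notin> full_level n k l" and y: "y \<in> {2 * k..n}" "y \<notin> A"
      then have "A \<inter> ?X \<noteq> {}" by (simp add: full_level_def)
      then obtain x where x: "x \<in> A" "x \<in> ?X" by blast
      define B where "B = insert y (A - {x})"
      have "card B = Suc (card (A - {x}))" using y(2) P(1)[OF A(1)] by (simp add: B_def)
      also have "\<dots> = k" using card_Suc_Diff1[OF P(1)[OF A(1)] x(1)] P(3)[OF A(1)] by simp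
      finally have "card B = k" .
      then have "B \<in> nsets {1..n} k"
        using y P[OF A(1)] l by (auto simp: B_def nsets_def)
      moreover have "B \<inter> {1..2 * l - 1} = A \<inter> {1..2 * l - 1}"
        using x y l by (auto simp: B_def)
      ultimately have BP: "B \<in> ?P" using first_level_cong[OF A(1)] by blast
      have "set_weight \<omega> A = \<omega> x * prod \<omega> (A - {x})"
        unfolding set_weight_def using P(1)[OF A(1)] x(1) by (rule prod.remove)
      also have "\<dots> \<le> \<omega> y * prod \<omega> (A - {x})"
      proof (rule mult_right_mono)
        show "\<omega> x \<le> \<omega> y" using weight_mono[OF \<omega>, of x y] x y l by auto
        show "0 \<le> prod \<omega> (A - {x})"
          using weight_nonneg[OF \<omega>] P(2)[OF A(1)] by (intro prod_nonneg) blast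
      qed
      also have "\<dots> = set_weight \<omega> B"
        unfolding set_weight_def B_def using P(1)[OF A(1)] y(2) by simp
      finally have le: "set_weight \<omega> A \<le> set_weight \<omega> B" .
      have "insert x (B - {y}) = A" using x(1) y(2) by (auto simp: B_def)
      then show "\<exists>t\<in>Sigma ?P (\<lambda>B. ?X \<times> B).
          (case t of (B, x, y) \<Rightarrow> (insert x (B - {y}), y)) = (A, y) \<and>
          set_weight \<omega> A \<le> (case t of (B, _) \<Rightarrow> set_weight \<omega> B)"
        using BP x le by (intro bexI[of _ "(B, x, y)"]) (auto simp: B_def)
    qed
  qed
  also have "\<dots> = (\<Sum>B\<in>?P. \<Sum>_\<in>?X \<times> B. set_weight \<omega> B)"
    using P(1) by (intro sum.Sigma[symmetric]) (auto simp: finite_first_level)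
  also have "\<dots> = real ((2 * k - 2 * l) * k) * family_weight \<omega> ?P"
    using P card_X by (simp add: family_weight_def sum_distrib_left card_cartesian_product mult.assoc
        del: card_atLeastAtMost)
  also have "\<dots> \<le> real (2 * (k - 1) * k) * family_weight \<omega> ?P"
  proof (rule mult_right_mono)
    show "real ((2 * k - 2 * l) * k) \<le> real (2 * (k - 1) * k)"
      unfolding of_nat_le_iff by (rule mult_right_mono) (use l in auto)
  qed (rule family_weight_nonneg[OF \<omega> first_level_nsets])
  finally show ?thesis .
qed

text \<open>Replacing the trace of \<open>A\<close> by the top one does not lower the weight. The
  result \<open>B\<close> and the old trace \<open>S\<close> determine \<open>A\<close>, and there
  are \<open>(2 * l - 1) choose l\<close> possible traces.\<close>

lemma first_level_weight_le:
  assumes \<omega>: "increasing_weight n \<omega>" and l: "1 \<le> l" "l \<le> k" and n: "2 * k \<le> n"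
  shows "family_weight \<omega> (first_level n k l) \<le> real ((2 * k) choose k) *
    family_weight \<omega> {A \<in> first_level n k l. A \<inter> {1..2 * l - 1} = {l..2 * l - 1}}"
    (is "_ \<le> _ * family_weight \<omega> ?Q")
proof -
  let ?P = "first_level n k l"
  let ?I = "{1..2 * l - 1}"
  let ?\<S> = "{S. S \<subseteq> ?I \<and> card S = l}"
  have P: "finite A" "A \<subseteq> {1..n}" "card A = k" if "A \<in> ?P" for A
    using that by (auto simp: first_level_def nsets_def)
  have fin: "finite ?\<S>" by (rule finite_subset[of _ "Pow ?I"]) auto
  have Q: "finite ?Q" using finite_first_level by simp
  have nonneg: "0 \<le> set_weight \<omega> A" if "A \<in> ?P" for A
    using set_weight_nonneg[OF \<omega>] P(2)[OF that] .
  have "family_weight \<omega> ?P \<le> (\<Sum>(B, S)\<in>?Q \<times> ?\<S>. set_weight \<omega> B)"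
    unfolding family_weight_def
  proof (rule sum_le_included[where i = "\<lambda>(B, S). S \<union> (B - ?I)"])
    show "finite ?P" by (rule finite_first_level)
    show "finite (?Q \<times> ?\<S>)" using Q fin by blast
    show "\<forall>z\<in>?Q \<times> ?\<S>. 0 \<le> (case z of (B, S) \<Rightarrow> set_weight \<omega> B)" using nonneg by auto
    show "\<forall>A\<in>?P. \<exists>z\<in>?Q \<times> ?\<S>. (case z of (B, S) \<Rightarrow> S \<union> (B - ?I)) = A \<and>
        set_weight \<omega> A \<le> (case z of (B, S) \<Rightarrow> set_weight \<omega> B)"
    proof
      fix A assume A: "A \<in> ?P"
      \<comment> \<open>The old trace has exactly \<open>l\<close> elements by
        \<open>first_level_card\<close>, so the size stays \<open>k\<close>.\<close>
      define B where "B = {l..2 * l - 1} \<union> (A - ?I)"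
      have cA: "card (A \<inter> ?I) = l" using first_level_card[OF A l(1)] .
      have disj: "{l..2 * l - 1} \<inter> (A - ?I) = {}" using l by auto
      have trace: "B \<inter> ?I = {l..2 * l - 1}" using l by (auto simp: B_def)
      have "card B = l + card (A - ?I)"
        using card_Un_disjoint[OF _ _ disj] P(1)[OF A] l by (simp add: B_def)
      also have "\<dots> = k"
        using cA card_Int_Diff[OF P(1)[OF A], of ?I] P(3)[OF A] by simp
      finally have "card B = k" .
      moreover have "{l..2 * l - 1} \<subseteq> {1..n}" using l n by auto
      ultimately have "B \<in> nsets {1..n} k"
        using P[OF A] by (auto simp: B_def nsets_def)
      then have BQ: "B \<in> ?Q" using first_level_top[of B n k l] trace l by simp
      have "set_weight \<omega> A = set_weight \<omega> (A \<inter> ?I) * set_weight \<omega> (A - ?I)"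
        unfolding set_weight_def using P(1)[OF A] by (rule prod.Int_Diff)
      also have "\<dots> \<le> set_weight \<omega> {l..2 * l - 1} * set_weight \<omega> (A - ?I)"
      proof (rule mult_right_mono)
        show "set_weight \<omega> (A \<inter> ?I) \<le> set_weight \<omega> {l..2 * l - 1}"
          using l n cA by (intro set_weight_le_top[OF \<omega>]) auto
        show "0 \<le> set_weight \<omega> (A - ?I)"
          using P(2)[OF A] by (intro set_weight_nonneg[OF \<omega>]) auto
      qed
      also have "\<dots> = set_weight \<omega> B"
        unfolding set_weight_def B_def using P(1)[OF A] disj
        by (intro prod.union_disjoint[symmetric]) auto
      finally have "set_weight \<omega> A \<le> set_weight \<omega> B" .
      moreover have "A \<inter> ?I \<union> (B - ?I) = A" using l by (auto simp: B_def)
      ultimately show "\<exists>z\<in>?Q \<times> ?\<S>. (case z of (B, S) \<Rightarrow> S \<union> (B - ?I)) = A \<and>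
          set_weight \<omega> A \<le> (case z of (B, S) \<Rightarrow> set_weight \<omega> B)"
        using BQ cA by (intro bexI[of _ "(B, A \<inter> ?I)"]) auto
    qed
  qed
  also have "\<dots> = real (card ?\<S>) * family_weight \<omega> ?Q"
    by (simp add: sum.cartesian_product[symmetric] family_weight_def sum_distrib_left)
  also have "\<dots> \<le> real ((2 * k) choose k) * family_weight \<omega> ?Q"
  proof (rule mult_right_mono)
    have "card ?\<S> = (2 * l - 1) choose l" using n_subsets[of ?I l] by simp
    also have "\<dots> \<le> (2 * k) choose l" using l by (intro binomial_right_mono) auto
    also have "\<dots> \<le> (2 * k) choose k" using binomial_maximum'[of k l] by simp
    finally show "real (card ?\<S>) \<le> real ((2 * k) choose k)" by simp
    show "0 \<le> family_weight \<omega> ?Q"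
      using first_level_nsets[of n k l] by (intro family_weight_nonneg[OF \<omega>, of _ k]) auto
  qed
  finally show ?thesis .
qed

section \<open>Optimal families are canonical\<close>

lemma optimal_is_canonical:
  fixes k n :: nat
  assumes n: "n \<ge> 3 * k ^ 3 * ((2 * k) choose k)"
    and \<omega>: "increasing_weight n \<omega>" and nontriv: "\<not> trivial_weight n k \<omega>"
    and opt: "optimal n k \<omega> \<F>"
  shows "\<exists>i\<in>{1..k}. \<F> = canonical_mlcif n k i"
proof (rule ccontr)
  assume non_canonical: "\<not> ?thesis"
  let ?C = "(2 * k) choose k"
  let ?P = "first_level n k"
  let ?full = "\<lambda>l. \<F> \<inter> full_level n k l"
  define W where "W = family_weight \<omega> \<F>"
  define N where "N = n - 3 * k"
  have F: "is_mlcif n k \<F>" and W_ge: "\<And>\<G>. is_mlcif n k \<G> \<Longrightarrow> family_weight \<omega> \<G> \<le> W"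
    using opt by (auto simp: optimal_def W_def)
  have lcif: "is_lcif n k \<F>" using F by (simp add: is_mlcif_def)
  then have Fn: "\<F> \<subseteq> nsets {1..n} k" by (simp add: is_lcif_def left_compressed_def)
  obtain \<G> where G: "is_mlcif n k \<G>" "family_weight \<omega> \<G> \<noteq> 0"
    using nontriv by (auto simp: trivial_weight_def)
  moreover have "\<G> \<subseteq> nsets {1..n} k"
    using G(1) by (simp add: is_mlcif_def is_lcif_def left_compressed_def)
  ultimately have W: "0 < W"
    using family_weight_nonneg[OF \<omega>, of \<G> k] W_ge[of \<G>] by linarith
  \<comment> \<open>For \<open>k = 0\<close> the only candidate member is the empty set, which does
    not meet itself, so \<open>W\<close> would be 0.\<close>
  have k: "1 \<le> k"
  proof (rule ccontr)
    assume "\<not> 1 \<le> k"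
    then have "\<F> \<subseteq> {{}}" using Fn by (auto simp: nsets_def not_le)
    then have "\<F> = {}" using lcif by (auto simp: is_lcif_def intersecting_def)
    then show False using W by (simp add: W_def family_weight_def)
  qed
  have "?C \<ge> (2 * k) choose 1" using binomial_maximum'[of k 1] by simp
  then have C: "?C \<ge> 2 * k" by simp
  \<comment> \<open>Splits the threshold for \<open>n\<close>: the first summand is what the final
    comparison with \<open>N\<close> requires, the second is at least \<open>6 * k\<close> and pays
    for the \<open>3 * k\<close> subtracted in \<open>N\<close>.\<close>
  have "3 * k ^ 3 * ?C = 2 * k ^ 2 * (k - 1) * ?C + (k ^ 3 + 2 * k ^ 2) * ?C"
    using k by (cases k) (simp_all add: power2_eq_square power3_eq_cube algebra_simps)
  moreover have "1 \<le> k ^ 3" "1 \<le> k ^ 2" using k by simp_all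
  then have "3 \<le> k ^ 3 + 2 * k ^ 2" by linarith
  then have "3 * (2 * k) \<le> (k ^ 3 + 2 * k ^ 2) * ?C" using C by (intro mult_mono) simp_all
  ultimately have big: "3 * k + 2 * k ^ 2 * (k - 1) * ?C < n" using n k by linarith
  then have n2: "2 * k \<le> n" and N: "2 * k ^ 2 * (k - 1) * ?C < N" by (simp_all add: N_def)
  \<comment> \<open>A whole level sits inside a canonical family, which optimality bounds by
    \<open>W\<close>.\<close>
  have P_le: "family_weight \<omega> (?P l) \<le> W" if "l \<in> {1..k}" for l
  proof -
    have "family_weight \<omega> (?P l) \<le> family_weight \<omega> (canonical_mlcif n k l)"
      by (rule family_weight_mono[OF \<omega> first_level_subset_canonical])
        (auto simp: canonical_mlcif_def)
    then show ?thesis using W_ge[OF canonical_is_mlcif[of l k n]] that n2 by simp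
  qed
  have full_le: "family_weight \<omega> (?full l) \<le> W - W / ?C" if l: "l \<in> {1..k}" for l
  proof -
    let ?Q = "{A \<in> ?P l. A \<inter> {1..2 * l - 1} = {l..2 * l - 1}}"
    \<comment> \<open>A full member with the top trace would make \<open>\<F>\<close>
      canonical.\<close>
    have "?full l \<inter> ?Q = {}"
      using mlcif_eq_canonical[OF F n2] l non_canonical by fastforce
    moreover have fin: "finite (?full l)" "finite ?Q"
      using finite_first_level[of n k l] by (auto simp: full_level_def)
    ultimately have "family_weight \<omega> (?full l) + family_weight \<omega> ?Q
        = family_weight \<omega> (?full l \<union> ?Q)"
      unfolding family_weight_def by (intro sum.union_disjoint[symmetric]) auto
    also have "\<dots> \<le> family_weight \<omega> (?P l)"
      by (rule family_weight_mono[OF \<omega> _ first_level_nsets]) (auto simp: full_level_def)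
    finally have sum: "family_weight \<omega> (?full l) + family_weight \<omega> ?Q \<le> family_weight \<omega> (?P l)" .
    have "family_weight \<omega> (?P l) \<le> ?C * family_weight \<omega> ?Q"
      using first_level_weight_le[OF \<omega> _ _ n2, of l] l by simp
    then have "family_weight \<omega> (?P l) / ?C \<le> family_weight \<omega> ?Q"
      using C k by (simp add: divide_simps mult.commute)
    then have "family_weight \<omega> (?full l) \<le> family_weight \<omega> (?P l) * (1 - 1 / ?C)"
      using sum by (simp add: algebra_simps)
    also have "\<dots> \<le> W * (1 - 1 / ?C)"
      using P_le[OF l] C k by (intro mult_right_mono) auto
    finally show ?thesis by (simp add: algebra_simps)
  qed
  \<comment> \<open>By \<open>full_level_unique\<close> at most one summand is nonzero, so the bound
    for a single level serves for all of them.\<close>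
  have full_sum: "(\<Sum>l\<in>{1..k}. family_weight \<omega> (?full l)) \<le> W - W / ?C"
  proof (cases "\<exists>s\<in>{1..k}. ?full s \<noteq> {}")
    case True
    then obtain s where s: "s \<in> {1..k}" "?full s \<noteq> {}" by blast
    have "?full l = {}" if "l \<in> {1..k} - {s}" for l
      using full_level_unique[OF lcif n2, of _ l _ s] s that by fastforce
    then have "(\<Sum>l\<in>{1..k}. family_weight \<omega> (?full l)) = (\<Sum>l\<in>{s}. family_weight \<omega> (?full l))"
      using s(1) by (intro sum.mono_neutral_right) (auto simp: family_weight_def)
    then show ?thesis using full_le[OF s(1)] by simp
  next
    case False
    then have "(\<Sum>l\<in>{1..k}. family_weight \<omega> (?full l)) = 0" by (simp add: family_weight_def)
    moreover have "W / ?C \<le> W" using W C k by (simp add: divide_simps)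
    ultimately show ?thesis by simp
  qed
  have non_full: "real N * family_weight \<omega> (?P l - full_level n k l) \<le> real (2 * (k - 1) * k) * W"
    if l: "l \<in> {1..k}" for l
    using non_full_weight_le[OF \<omega>, of l k] P_le[OF l] l
      mult_left_mono[OF P_le[OF l], of "real (2 * (k - 1) * k)"] unfolding N_def by auto
  have W_sum: "W \<le> (\<Sum>l\<in>{1..k}. family_weight \<omega> (?full l))
      + (\<Sum>l\<in>{1..k}. family_weight \<omega> (?P l - full_level n k l))"
  proof -
    have "\<F> = (\<Union>l\<in>{1..k}. \<F> \<inter> ?P l)" using lcif_subset_first_levels[OF lcif n2] by blast
    then have "W = (\<Sum>A\<in>(\<Union>l\<in>{1..k}. \<F> \<inter> ?P l). set_weight \<omega> A)"
      by (simp add: W_def family_weight_def)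
    also have "\<dots> = (\<Sum>l\<in>{1..k}. family_weight \<omega> (\<F> \<inter> ?P l))"
      unfolding family_weight_def
    proof (rule sum.UNION_disjoint)
      show "\<forall>i\<in>{1..k}. \<forall>j\<in>{1..k}. i \<noteq> j \<longrightarrow> (\<F> \<inter> ?P i) \<inter> (\<F> \<inter> ?P j) = {}"
        using first_level_disjoint[of _ _ n k] by fastforce
    qed (auto simp: finite_first_level)
    also have "\<dots> \<le> (\<Sum>l\<in>{1..k}. family_weight \<omega> (?full l)
        + family_weight \<omega> (?P l - full_level n k l))"
    proof (rule sum_mono)
      fix l
      have "family_weight \<omega> (\<F> \<inter> ?P l)
          \<le> family_weight \<omega> (?full l \<union> (?P l - full_level n k l))"
        by (rule family_weight_mono[OF \<omega>, of _ _ k])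
          (use first_level_nsets in \<open>auto simp: full_level_def\<close>)
      also have "\<dots> = family_weight \<omega> (?full l) + family_weight \<omega> (?P l - full_level n k l)"
        unfolding family_weight_def using finite_first_level[of n k l]
        by (intro sum.union_disjoint) (auto simp: full_level_def)
      finally show "family_weight \<omega> (\<F> \<inter> ?P l)
          \<le> family_weight \<omega> (?full l) + family_weight \<omega> (?P l - full_level n k l)" .
    qed
    finally show ?thesis by (simp add: sum.distrib)
  qed
  \<comment> \<open>The non-full sets must supply the missing \<open>W / ?C\<close>. Over
    \<open>k\<close> levels they supply at most \<open>2 * k ^ 2 * (k - 1) * W / N\<close>, which is
    too little by the choice of \<open>N\<close>.\<close>
  have "W / ?C \<le> (\<Sum>l\<in>{1..k}. family_weight \<omega> (?P l - full_level n k l))"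
    using W_sum full_sum by simp
  then have "real N * (W / ?C)
      \<le> real N * (\<Sum>l\<in>{1..k}. family_weight \<omega> (?P l - full_level n k l))"
    by (rule mult_left_mono) simp
  also have "\<dots> = (\<Sum>l\<in>{1..k}. real N * family_weight \<omega> (?P l - full_level n k l))"
    by (rule sum_distrib_left)
  also have "\<dots> \<le> (\<Sum>l\<in>{1..k}. real (2 * (k - 1) * k) * W)" by (rule sum_mono) (rule non_full)
  also have "\<dots> = real (2 * k ^ 2 * (k - 1)) * W"
    using k by (simp add: power2_eq_square of_nat_diff)
  finally have "real N * W \<le> real (2 * k ^ 2 * (k - 1)) * W * ?C"
    using C k by (simp add: divide_simps)
  then have "real N * W \<le> real (2 * k ^ 2 * (k - 1) * ?C) * W" by (simp add: mult_ac)
  then have "real N \<le> real (2 * k ^ 2 * (k - 1) * ?C)" using W mult_right_le_imp_le by blast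
  then show False using N by linarith
qed

section \<open>Weights with a prescribed unique optimum\<close>

text \<open>There are finitely many families, so the maximum is attained; whatever attains it is
  optimal, hence equal to \<open>\<F>\<close>.\<close>

lemma uniquely_optimalI:
  assumes unique: "\<And>\<G>. optimal n k \<omega> \<G> \<Longrightarrow> \<G> = \<F>" and F: "is_mlcif n k \<F>"
  shows "uniquely_optimal n k \<omega> \<F>"
proof -
  let ?S = "{\<G>. is_mlcif n k \<G>}"
  have "?S \<subseteq> Pow (nsets {1..n} k)"
    by (auto simp: is_mlcif_def is_lcif_def left_compressed_def)
  then have fin: "finite ?S" by (rule finite_subset) (intro finite_Pow_iff[THEN iffD2] finite_nsets_upto)
  define M where "M = Max (family_weight \<omega> ` ?S)"
  have M: "family_weight \<omega> \<G> \<le> M" if "is_mlcif n k \<G>" for \<G>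
    unfolding M_def using fin that by (intro Max_ge) auto
  have eq: "\<G> = \<F>" if "is_mlcif n k \<G>" "family_weight \<omega> \<G> = M" for \<G>
    using unique[of \<G>] that M by (simp add: optimal_def)
  have "M \<in> family_weight \<omega> ` ?S" unfolding M_def using fin F by (intro Max_in) auto
  then have "family_weight \<omega> \<F> = M" using eq by auto
  then show ?thesis
    unfolding uniquely_optimal_def using F M eq by (metis order_le_less)
qed

text \<open>By \<open>optimal_is_canonical\<close> only the other canonical families have to be
  beaten; the value \<open>t ^ (k - i)\<close> separates them from the \<open>i\<close>-th.\<close>

lemma ex_weight_canonical_uniquely_optimal:
  fixes k n :: nat
  assumes n: "n \<ge> 3 * k ^ 3 * ((2 * k) choose k)" and i: "i \<in> {1..k}"
  shows "\<exists>\<omega>. increasing_weight n \<omega> \<and> uniquely_optimal n k \<omega> (canonical_mlcif n k i)"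
proof -
  have "3 * k ^ 3 * ((2 * k) choose k) \<ge> 3 * k * 1"
    using i binomial_maximum'[of k 0] by (intro mult_mono) (auto simp: self_le_power)
  then have n3: "3 * k \<le> n" using n by simp
  \<comment> \<open>Larger than the number of \<open>k\<close>-sets, so one extra factor
    \<open>t\<close> outweighs any number of sets.\<close>
  define t where "t = real (card (nsets {1..n} k)) + 1"
  define \<omega> :: "nat \<Rightarrow> real" where "\<omega> x = (if x < i then 0 else if x < 2 * k then 1 else t)" for x
  have t: "1 \<le> t" by (simp add: t_def)
  have inc: "increasing_weight n \<omega>"
    using t i by (auto simp: increasing_weight_def weight_function_def \<omega>_def intro!: mono_onI)
  have canonical_sub: "canonical_mlcif n k j \<subseteq> nsets {1..n} k" for j
    by (auto simp: canonical_mlcif_def)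
  \<comment> \<open>At least \<open>j\<close> elements lie below \<open>2 * k\<close> and have
    weight at most 1, leaving at most \<open>k - j\<close> factors \<open>t\<close>.\<close>
  have set_weight_le: "set_weight \<omega> A \<le> t ^ (k - j)" if A: "A \<in> canonical_mlcif n k j" and j: "j \<le> k" for A j
  proof -
    have A': "finite A" "card A = k" "j \<le> card (A \<inter> {1..2 * j - 1})"
      using A by (auto simp: canonical_mlcif_def nsets_def)
    let ?H = "A - {1..2 * j - 1}"
    have "set_weight \<omega> A = prod \<omega> (A \<inter> {1..2 * j - 1}) * prod \<omega> ?H"
      unfolding set_weight_def using A'(1) by (rule prod.Int_Diff)
    also have "\<dots> \<le> 1 * t ^ card ?H"
    proof (rule mult_mono)
      show "prod \<omega> (A \<inter> {1..2 * j - 1}) \<le> 1"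
        using j by (intro prod_le_1) (auto simp: \<omega>_def)
      have "prod \<omega> ?H \<le> (\<Prod>x\<in>?H. t)"
        using t by (intro prod_mono) (auto simp: \<omega>_def)
      then show "prod \<omega> ?H \<le> t ^ card ?H" by simp
      show "0 \<le> prod \<omega> ?H" using t by (intro prod_nonneg) (auto simp: \<omega>_def)
    qed simp
    also have "\<dots> \<le> t ^ (k - j)"
    proof -
      have "card ?H = k - card (A \<inter> {1..2 * j - 1})"
        using A' card_Diff_subset_Int[of A "{1..2 * j - 1}"] by simp
      then show ?thesis using A'(3) t by (simp add: power_increasing)
    qed
    finally show ?thesis .
  qed
  have canonical_i: "t ^ (k - i) \<le> family_weight \<omega> (canonical_mlcif n k i)"
  proof -
    \<comment> \<open>A single member reaching the bound: \<open>i\<close> elements of weight 1 and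
      \<open>k - i\<close> of weight \<open>t\<close>.\<close>
    define A where "A = {i..2 * i - 1} \<union> {2 * k..<3 * k - i}"
    have sub: "A \<subseteq> {1..n}" using i n3 by (auto simp: A_def)
    have disj: "{i..2 * i - 1} \<inter> {2 * k..<3 * k - i} = {}" using i by auto
    have "card A = k" using i disj by (simp add: A_def card_Un_disjoint)
    moreover have "A \<inter> {1..2 * i - 1} = {i..2 * i - 1}" using i by (auto simp: A_def)
    ultimately have "A \<in> canonical_mlcif n k i"
      using sub i by (auto simp: canonical_mlcif_def nsets_def A_def)
    then have "family_weight \<omega> {A} \<le> family_weight \<omega> (canonical_mlcif n k i)"
      by (intro family_weight_mono[OF inc _ canonical_sub]) auto
    moreover have "prod \<omega> A = prod \<omega> {i..2 * i - 1} * prod \<omega> {2 * k..<3 * k - i}"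
      unfolding A_def using disj by (intro prod.union_disjoint) auto
    moreover have "prod \<omega> {i..2 * i - 1} = 1" using i by (intro prod.neutral) (auto simp: \<omega>_def)
    moreover have "prod \<omega> {2 * k..<3 * k - i} = (\<Prod>x\<in>{2 * k..<3 * k - i}. t)"
      using i by (intro prod.cong) (auto simp: \<omega>_def)
    ultimately show ?thesis by (simp add: family_weight_def set_weight_def)
  qed
  have pos: "0 < t ^ (k - i)" using t by simp
  have less: "family_weight \<omega> (canonical_mlcif n k j) < t ^ (k - i)"
    if j: "j \<in> {1..k}" "j \<noteq> i" for j
  proof (cases "j < i")
    case True
    \<comment> \<open>Only \<open>2 * j - i < j\<close> points of \<open>{1..2 * j - 1}\<close> are
      at least \<open>i\<close>, so \<open>A\<close> contains a point below \<open>i\<close>, of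
      weight 0.\<close>
    have "set_weight \<omega> A = 0" if A: "A \<in> canonical_mlcif n k j" for A
    proof -
      have fin: "finite A" and "j \<le> card (A \<inter> {1..2 * j - 1})"
        using A by (auto simp: canonical_mlcif_def nsets_def)
      moreover have "card {i..2 * j - 1} < j" using True j by auto
      ultimately have "\<not> A \<inter> {1..2 * j - 1} \<subseteq> {i..2 * j - 1}"
        using card_mono[of "{i..2 * j - 1}" "A \<inter> {1..2 * j - 1}"] by auto
      then obtain x where "x \<in> A" "x < i" by fastforce
      then show ?thesis unfolding set_weight_def using fin by (intro prod_zero) (auto simp: \<omega>_def)
    qed
    then show ?thesis using pos by (simp add: family_weight_def)
  next
    case False
    then have ji: "i < j" using j by simp
    \<comment> \<open>Fewer than \<open>t\<close> sets, each of weight at most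
      \<open>t ^ (k - j)\<close>, stay below \<open>t ^ Suc (k - j)\<close>, and
      \<open>Suc (k - j) \<le> k - i\<close>.\<close>
    have "family_weight \<omega> (canonical_mlcif n k j)
        \<le> real (card (canonical_mlcif n k j)) * t ^ (k - j)"
      unfolding family_weight_def using j set_weight_le by (intro sum_bounded_above) auto
    also have "\<dots> < t * t ^ (k - j)"
      using card_mono[OF finite_nsets_upto canonical_sub, of j] t
      by (intro mult_strict_right_mono) (auto simp: t_def)
    also have "\<dots> = t ^ Suc (k - j)" by simp
    also have "\<dots> \<le> t ^ (k - i)" using ji j t by (intro power_increasing) auto
    finally show ?thesis .
  qed
  have mlcif: "is_mlcif n k (canonical_mlcif n k i)"
    using i n3 by (intro canonical_is_mlcif) auto
  have "\<G> = canonical_mlcif n k i" if opt: "optimal n k \<omega> \<G>" for \<G>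
  proof -
    have "\<not> trivial_weight n k \<omega>"
      using mlcif canonical_i pos by (fastforce simp: trivial_weight_def)
    then obtain j where j: "j \<in> {1..k}" "\<G> = canonical_mlcif n k j"
      using optimal_is_canonical[OF n inc _ opt] by blast
    moreover have "family_weight \<omega> (canonical_mlcif n k i) \<le> family_weight \<omega> \<G>"
      using opt mlcif by (simp add: optimal_def)
    ultimately show ?thesis using less[of j] canonical_i by force
  qed
  then have "uniquely_optimal n k \<omega> (canonical_mlcif n k i)"
    using mlcif by (rule uniquely_optimalI)
  then show ?thesis using inc by blast
qed

theorem theorem1p2:
  fixes k n :: nat
  assumes "n \<ge> 3 * k ^ 3 * ((2 * k) choose k)"
  shows "(\<forall>\<omega> \<F>. increasing_weight n \<omega> \<and> \<not> trivial_weight n k \<omega> \<and> optimal n k \<omega> \<F>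
             \<longrightarrow> (\<exists>i\<in>{1..k}. \<F> = canonical_mlcif n k i))
       \<and> (\<forall>i\<in>{1..k}. \<exists>\<omega>. increasing_weight n \<omega>
             \<and> uniquely_optimal n k \<omega> (canonical_mlcif n k i))"
  using optimal_is_canonical[OF assms] ex_weight_canonical_uniquely_optimal[OF assms] by blast

end
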